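(* Fix $\lambda,\mu,\beta>0$ with $\mu<\lambda+\beta$, and let $\alpha>0$ range over the values with $\lambda<\frac{\beta}{\alpha+\beta}\mu$ (it is assumed such values exist, and then all sufficiently small $\alpha>0$ qualify). For each such $\alpha$ let $\pi$ be the stationary distribution of Model 1 (the unreliable $M/M/1$ server) with parameters $\lambda,\mu,\alpha,\beta$, and let $\gamma_1$, $C^{(1)}(U)$ be the associated constants. Then $$\lim_{k\to\infty}\ \lim_{\alpha\to0}\ \frac{\pi(k,U)}{C^{(1)}(U)\,\gamma_1^k}=1 .$$
   Context: $\mathbb N=\{0,1,2,\dots\}$; $U$ = Up, $D$ = Down. Model 1: the continuous-time Markov chain on $\mathbb N\times\{U,D\}$ (number of customers, server status) with transition intensities: $(x,\sigma)\to(x+1,\sigma)$ at rate $\lambda$ for all $x\ge 0$, $\sigma\in\{U,D\}$; $(x,U)\to(x-1,U)$ at rate $\mu$ for $x\ge1$; $(x,U)\to(x,D)$ at rate $\alpha$ and $(x,D)\to(x,U)$ at rate $\beta$ for all $x\ge0$. Under $\lambda<\frac{\beta}{\alpha+\beta}\mu$ it has a unique stationary distribution $\pi$ (depending on $\alpha$). Constants (all depending on $\alpha$): $$s_1=(\mu-\lambda-\beta-\alpha)^2+4\alpha\mu,\qquad \gamma_1=\frac{2\lambda}{\lambda+\beta+\mu+\alpha-\sqrt{s_1}}\in(0,1),$$ $$G=\frac{\lambda+\beta-\mu-\alpha+\sqrt{s_1}}{2}+\frac{2\alpha\beta}{\lambda+\beta-\mu-\alpha+\sqrt{s_1}},\qquad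 C^{(1)}(U)=\frac{\eta^{(1)}}{\tilde d^{(1)}}\cdot\frac1G\cdot\frac{\lambda+\beta-\mu-\alpha+\sqrt{s_1}}{2}.$$ Here $C\ge\lambda+\mu+\alpha+\beta$ is a uniformization constant (fixed, valid for all small $\alpha$) and $$\tilde d^{(1)}=\frac1C\left(\frac{\lambda+\beta+\mu+\alpha-\sqrt{s_1}}{2}-\frac1G\,\lambda\mu\,\frac{\lambda+\beta-\mu-\alpha+\sqrt{s_1}}{\lambda+\beta+\mu+\alpha-\sqrt{s_1}}\right).$$ Definition of $\eta^{(1)}$: let $\mathbf K^\infty$ be the kernel on $\mathbb Z\times\{U,D\}$ (the free process), shift invariant in the first coordinate, with $\mathbf K^\infty((m,\sigma),(m+1,\sigma))=\lambda/C$ for $\sigma\in\{U,D\}$, $\mathbf K^\infty((m,U),(m-1,U))=\mu/C$, $\mathbf K^\infty((m,U),(m,D))=\alpha/C$, $\mathbf K^\infty((m,D),(m,U))=\beta/C$, $\mathbf K^\infty((m,D),(m,D))=1-\frac{\lambda+\beta}{C}$, $\mathbf K^\infty((m,U),(m,U))=1-\frac{\lambda+\mu+\alpha}{C}$. Let $h(x,U)=\gamma_1^{-x}$ and $h(x,D)=\gamma_1^{-x}\,\frac{2\beta}{\lambda+\beta-\mu-\alpha+\sqrt{s_1}}$, and let the twisted free process be the discrete-time Markov chain with transition kernel $\mathcal K(z,z')=\mathbf K^\infty(z,z')h(z')/h(z)$. Then $$\eta^{(1)}=\sum_{\sigma\in\{U,D\}}\pi(0,\sigma)\,h(0,\sigma)\,\mathcal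 H(0,\sigma),$$ where $\mathcal H(0,\sigma)$ is the probability that the twisted free process started at $(0,\sigma)$ has strictly positive first coordinate at all times $n\ge1$. *)

theory Defs
  imports "HOL-Probability.Probability"
begin

datatype status = Up | Down

text \<open>A continuous-time Markov chain is represented by its transition function: \<open>P t z\<close> is the
  law at time \<open>t \<ge> 0\<close> of the chain started in \<open>z\<close> (the values at \<open>t < 0\<close> are irrelevant).  The
  diagonal condition says that the chain is conservative: the total rate out of \<open>z\<close> is the sum
  of the intensities \<open>q z z'\<close> over \<open>z' \<noteq> z\<close>.\<close>

definition ctmc :: "('s \<Rightarrow> 's \<Rightarrow> real) \<Rightarrow> (real \<Rightarrow> 's \<Rightarrow> 's pmf) \<Rightarrow> bool" where
  "ctmc q P \<longleftrightarrow>
     (\<forall>z. P 0 z = return_pmf z) \<and>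
     (\<forall>s\<ge>0. \<forall>t\<ge>0. \<forall>z. P (s + t) z = bind_pmf (P s z) (P t)) \<and>
     (\<forall>z z'. z \<noteq> z' \<longrightarrow> ((\<lambda>t. pmf (P t z) z') has_real_derivative q z z') (at_right 0)) \<and>
     (\<forall>z. ((\<lambda>t. pmf (P t z) z) has_real_derivative - (\<Sum>\<^sub>\<infinity>z'\<in>- {z}. q z z')) (at_right 0))"

definition stationary_distribution :: "(real \<Rightarrow> 's \<Rightarrow> 's pmf) \<Rightarrow> 's pmf \<Rightarrow> bool" where
  "stationary_distribution P p \<longleftrightarrow> (\<forall>t\<ge>0. bind_pmf p (P t) = p)"

fun rate1 :: "real \<Rightarrow> real \<Rightarrow> real \<Rightarrow> real \<Rightarrow> nat \<times> status \<Rightarrow> nat \<times> status \<Rightarrow> real" where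
  "rate1 lam \<mu> \<alpha> \<beta> (x, \<sigma>) (x', \<sigma>') =
     (if x' = x + 1 \<and> \<sigma>' = \<sigma> then lam
      else if x \<ge> 1 \<and> x' = x - 1 \<and> \<sigma> = Up \<and> \<sigma>' = Up then \<mu>
      else if x' = x \<and> \<sigma> = Up \<and> \<sigma>' = Down then \<alpha>
      else if x' = x \<and> \<sigma> = Down \<and> \<sigma>' = Up then \<beta>
      else 0)"

definition s1 :: "real \<Rightarrow> real \<Rightarrow> real \<Rightarrow> real \<Rightarrow> real" where
  "s1 lam \<mu> \<alpha> \<beta> = (\<mu> - lam - \<beta> - \<alpha>)\<^sup>2 + 4 * \<alpha> * \<mu>"

definition gamma1 :: "real \<Rightarrow> real \<Rightarrow> real \<Rightarrow> real \<Rightarrow> real" where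
  "gamma1 lam \<mu> \<alpha> \<beta> = 2 * lam / (lam + \<beta> + \<mu> + \<alpha> - sqrt (s1 lam \<mu> \<alpha> \<beta>))"

definition G1 :: "real \<Rightarrow> real \<Rightarrow> real \<Rightarrow> real \<Rightarrow> real" where
  "G1 lam \<mu> \<alpha> \<beta> =
     (lam + \<beta> - \<mu> - \<alpha> + sqrt (s1 lam \<mu> \<alpha> \<beta>)) / 2
     + 2 * \<alpha> * \<beta> / (lam + \<beta> - \<mu> - \<alpha> + sqrt (s1 lam \<mu> \<alpha> \<beta>))"

definition d1 :: "real \<Rightarrow> real \<Rightarrow> real \<Rightarrow> real \<Rightarrow> real \<Rightarrow> real" where
  "d1 C lam \<mu> \<alpha> \<beta> =
     1 / C * ((lam + \<beta> + \<mu> + \<alpha> - sqrt (s1 lam \<mu> \<alpha> \<beta>)) / 2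
       - 1 / G1 lam \<mu> \<alpha> \<beta> * lam * \<mu>
         * ((lam + \<beta> - \<mu> - \<alpha> + sqrt (s1 lam \<mu> \<alpha> \<beta>))
            / (lam + \<beta> + \<mu> + \<alpha> - sqrt (s1 lam \<mu> \<alpha> \<beta>))))"

fun free_kernel :: "real \<Rightarrow> real \<Rightarrow> real \<Rightarrow> real \<Rightarrow> real \<Rightarrow> int \<times> status \<Rightarrow> int \<times> status \<Rightarrow> real" where
  "free_kernel C lam \<mu> \<alpha> \<beta> (m, \<sigma>) (m', \<sigma>') =
     (if m' = m + 1 \<and> \<sigma>' = \<sigma> then lam / C
      else if m' = m - 1 \<and> \<sigma> = Up \<and> \<sigma>' = Up then \<mu> / C
      else if m' = m \<and> \<sigma> = Up \<and> \<sigma>' = Down then \<alpha> / C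
      else if m' = m \<and> \<sigma> = Down \<and> \<sigma>' = Up then \<beta> / C
      else if m' = m \<and> \<sigma> = Down \<and> \<sigma>' = Down then 1 - (lam + \<beta>) / C
      else if m' = m \<and> \<sigma> = Up \<and> \<sigma>' = Up then 1 - (lam + \<mu> + \<alpha>) / C
      else 0)"

fun h1 :: "real \<Rightarrow> real \<Rightarrow> real \<Rightarrow> real \<Rightarrow> int \<times> status \<Rightarrow> real" where
  "h1 lam \<mu> \<alpha> \<beta> (x, Up) = gamma1 lam \<mu> \<alpha> \<beta> powi (- x)"
| "h1 lam \<mu> \<alpha> \<beta> (x, Down) =
     gamma1 lam \<mu> \<alpha> \<beta> powi (- x) * (2 * \<beta> / (lam + \<beta> - \<mu> - \<alpha> + sqrt (s1 lam \<mu> \<alpha> \<beta>)))"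

definition twisted_kernel ::
  "real \<Rightarrow> real \<Rightarrow> real \<Rightarrow> real \<Rightarrow> real \<Rightarrow> int \<times> status \<Rightarrow> int \<times> status \<Rightarrow> real" where
  "twisted_kernel C lam \<mu> \<alpha> \<beta> z z' =
     free_kernel C lam \<mu> \<alpha> \<beta> z z' * h1 lam \<mu> \<alpha> \<beta> z' / h1 lam \<mu> \<alpha> \<beta> z"

text \<open>\<open>embed_pmf\<close> turns a mass function into the distribution it describes; it is unspecified
  unless the function is nonnegative with total mass 1.  This is satisfied here because \<open>h1\<close> is a
  positive harmonic function of \<open>free_kernel\<close> whenever all rates are positive and
  \<open>C \<ge> lam + \<mu> + \<alpha> + \<beta>\<close>.\<close>

definition twisted_step ::
  "real \<Rightarrow> real \<Rightarrow> real \<Rightarrow> real \<Rightarrow> real \<Rightarrow> int \<times> status \<Rightarrow> (int \<times> status) pmf" where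
  "twisted_step C lam \<mu> \<alpha> \<beta> z = embed_pmf (twisted_kernel C lam \<mu> \<alpha> \<beta> z)"

text \<open>The law on path space of the discrete-time Markov chain with one-step distributions \<open>k\<close>
  started in \<open>z\<close>, obtained from the Ionescu-Tulcea theorem: the coordinate at time 0 is \<open>z\<close>, and
  given the coordinates before time \<open>n + 1\<close> the one at time \<open>n + 1\<close> has law \<open>k (\<omega> n)\<close>.\<close>

fun chain_step :: "('s \<Rightarrow> 's pmf) \<Rightarrow> 's \<Rightarrow> nat \<Rightarrow> (nat \<Rightarrow> 's) \<Rightarrow> 's measure" where
  "chain_step k z 0 \<omega> = measure_pmf (return_pmf z)"
| "chain_step k z (Suc n) \<omega> = measure_pmf (k (\<omega> n))"

lemma Ionescu_Tulcea_chain: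
  fixes k :: "'s \<Rightarrow> 's pmf"
  shows "Ionescu_Tulcea (chain_step k z) (\<lambda>_. count_space UNIV)"
proof (rule Ionescu_Tulcea.intro)
  fix i
  show "chain_step k z i
      \<in> PiM {0..<i} (\<lambda>_. count_space UNIV) \<rightarrow>\<^sub>M subprob_algebra (count_space UNIV)"
  proof (cases i)
    case 0
    then have "chain_step k z i = (\<lambda>_. measure_pmf (return_pmf z))"
      by (simp add: fun_eq_iff)
    moreover have "measure_pmf (return_pmf z) \<in> space (subprob_algebra (count_space UNIV))"
      by (simp add: space_subprob_algebra measure_pmf.subprob_space_axioms)
    ultimately show ?thesis
      by simp
  next
    case (Suc n)
    then have eq: "chain_step k z i = (\<lambda>\<omega>. measure_pmf (k (\<omega> n)))"
      by (simp add: fun_eq_iff)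
    have coord: "(\<lambda>\<omega>. \<omega> n) \<in> PiM {0..<i} (\<lambda>_. count_space UNIV) \<rightarrow>\<^sub>M count_space UNIV"
      using Suc by (intro measurable_component_singleton) auto
    have kernel: "(\<lambda>s. measure_pmf (k s)) \<in> count_space UNIV \<rightarrow>\<^sub>M subprob_algebra (count_space UNIV)"
      by (simp add: space_subprob_algebra measure_pmf.subprob_space_axioms)
    show ?thesis
      using measurable_compose[OF coord kernel] by (simp only: eq)
  qed
next
  fix i and \<omega> :: "nat \<Rightarrow> 's"
  show "prob_space (chain_step k z i \<omega>)"
    by (cases i) (simp_all add: measure_pmf.prob_space_axioms)
qed

definition chain_paths :: "('s \<Rightarrow> 's pmf) \<Rightarrow> 's \<Rightarrow> (nat \<Rightarrow> 's) measure" where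
  "chain_paths k z =
     projective_family.lim UNIV
       (Ionescu_Tulcea.CI (chain_step k z) (\<lambda>_. count_space UNIV)) (\<lambda>_. count_space UNIV)"

definition stay_positive_prob ::
  "real \<Rightarrow> real \<Rightarrow> real \<Rightarrow> real \<Rightarrow> real \<Rightarrow> int \<times> status \<Rightarrow> real" where
  "stay_positive_prob C lam \<mu> \<alpha> \<beta> z =
     measure (chain_paths (twisted_step C lam \<mu> \<alpha> \<beta>) z) {\<omega>. \<forall>n\<ge>1. fst (\<omega> n) > 0}"

definition eta1 ::
  "real \<Rightarrow> real \<Rightarrow> real \<Rightarrow> real \<Rightarrow> real \<Rightarrow> (nat \<times> status) pmf \<Rightarrow> real" where
  "eta1 C lam \<mu> \<alpha> \<beta> p =
     (\<Sum>\<sigma>\<in>{Up, Down}. pmf p (0, \<sigma>) * h1 lam \<mu> \<alpha> \<beta> (0, \<sigma>) * stay_positive_prob C lam \<mu> \<alpha> \<beta> (0, \<sigma>))"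

definition CU1 ::
  "real \<Rightarrow> real \<Rightarrow> real \<Rightarrow> real \<Rightarrow> real \<Rightarrow> (nat \<times> status) pmf \<Rightarrow> real" where
  "CU1 C lam \<mu> \<alpha> \<beta> p =
     eta1 C lam \<mu> \<alpha> \<beta> p / d1 C lam \<mu> \<alpha> \<beta> * (1 / G1 lam \<mu> \<alpha> \<beta>)
     * ((lam + \<beta> - \<mu> - \<alpha> + sqrt (s1 lam \<mu> \<alpha> \<beta>)) / 2)"

end

theory Submission
  imports Defs "HOL-Real_Asymp.Real_Asymp"
begin

text \<open>
  For each \<open>k\<close> the inner limit is already 1.  Balancing the flow of customers across the cut between
  \<open>k\<close> and \<open>k + 1\<close> gives \<open>lam * (\<pi> (k, Up) + \<pi> (k, Down)) = \<mu> * \<pi> (k + 1, Up)\<close>, and summing the balance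
  equations gives \<open>\<pi> (0, Up) = \<beta> / (\<alpha> + \<beta>) - lam / \<mu>\<close> and \<open>\<pi> (\<nat>, Down) = \<alpha> / (\<alpha> + \<beta>)\<close>.  Hence, with
  \<open>\<rho> = lam / \<mu>\<close>, \<open>\<pi> (k, Up)\<close> tends to \<open>(1 - \<rho>) * \<rho> ^ k\<close> and \<open>\<pi> (0, Down)\<close> to 0.

  Since constants are harmonic for the free kernel, \<open>1 / h\<close> is harmonic for the twisted chain; it is the
  probability of ever reaching level 0 from a positive level.  So from \<open>(0, Up)\<close> the twisted chain stays positive with
  probability exactly \<open>lam / (\<gamma> * C) * (1 - \<gamma>)\<close>, which tends to \<open>(\<mu> - lam) / C\<close> because
  \<open>\<gamma>\<close> tends to \<open>\<rho>\<close>.  Therefore \<open>\<eta>\<close> tends to \<open>(1 - \<rho>) * (\<mu> - lam) / C\<close> and \<open>C(U)\<close> to \<open>1 - \<rho>\<close>.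
\<close>

section \<open>Balance equations from the transition function\<close>

definition exit_rate :: "('s \<Rightarrow> 's \<Rightarrow> real) \<Rightarrow> 's \<Rightarrow> real" where
  "exit_rate q z = (\<Sum>\<^sub>\<infinity>z'\<in>- {z}. q z z')"

lemma pmf_add_le_one: "x \<noteq> y \<Longrightarrow> pmf p x + pmf p y \<le> 1"
  using measure_pmf.prob_le_1[of p "{x, y}"] by (simp add: measure_measure_pmf_finite)

text \<open>The function \<open>g t = 1 - pmf (P t z) z\<close> is subadditive, so
  \<open>g t \<le> n * g (t / n)\<close>, and the right-hand side tends to
  \<open>exit_rate q z * t\<close> because \<open>g\<close> is differentiable at 0. This linear
  bound provides the dominating constant for the balance equations.\<close>

lemma ctmc_exit_probability_le:
  assumes "ctmc q P" and "0 \<le> t"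
  shows "1 - pmf (P t z) z \<le> exit_rate q z * t"
proof -
  define g where "g t = 1 - pmf (P t z) z" for t
  have subadd: "g (s + t) \<le> g s + g t" if "0 \<le> s" "0 \<le> t" for s t
  proof -
    have "pmf (P (s + t) z) z = measure_pmf.expectation (P s z) (\<lambda>w. pmf (P t w) z)"
      using assms(1) that by (simp add: ctmc_def pmf_bind)
    \<comment> \<open>Only the event of being at \<open>z\<close> at the intermediate time
      \<open>s\<close> is kept.\<close>
    also have "\<dots> \<ge> measure_pmf.expectation (P s z) (\<lambda>w. indicator {z} w * pmf (P t z) z)"
      by (intro integral_mono measure_pmf.integrable_const_bound[where B = 1])
         (auto simp: pmf_le_1 split: split_indicator)
    finally have "pmf (P s z) z * pmf (P t z) z \<le> pmf (P (s + t) z) z"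
      by (simp add: pmf.rep_eq)
    \<comment> \<open>For two numbers a, b in [0, 1] this is 1 - a * b \<le> (1 - a) + (1 -
      b).\<close>
    moreover have "0 \<le> (1 - pmf (P s z) z) * (1 - pmf (P t z) z)"
      by (simp add: pmf_le_1)
    ultimately show ?thesis
      by (simp add: g_def algebra_simps)
  qed
  have zero: "g 0 = 0"
    using assms(1) by (simp add: ctmc_def g_def)
  have iterate: "g (real n * s) \<le> real n * g s" if "0 \<le> s" for n s
  proof (induction n)
    case (Suc n)
    have "g (real n * s + s) \<le> g (real n * s) + g s"
      using that by (intro subadd) auto
    with Suc show ?case
      by (simp add: algebra_simps)
  qed (simp add: zero)
  show ?thesis
  proof (cases "t = 0")
    case True
    with zero show ?thesis by (simp add: g_def)
  next
    case False
    with assms have "0 < t" by simp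
    have "(g has_real_derivative exit_rate q z) (at_right 0)"
      unfolding g_def using assms(1)
      by (auto simp: ctmc_def exit_rate_def intro!: derivative_eq_intros)
    then have lim: "((\<lambda>h. g h / h) \<longlongrightarrow> exit_rate q z) (at_right 0)"
      by (simp add: has_field_derivative_iff zero)
    have "filterlim (\<lambda>n. t / real (Suc n)) (at_right 0) sequentially"
      using \<open>0 < t\<close> by (intro tendsto_imp_filterlim_at_right) real_asymp+
    from filterlim_compose[OF lim this]
    have "(\<lambda>n. g (t / real (Suc n)) / (t / real (Suc n)) * t) \<longlonglongrightarrow> exit_rate q z * t"
      by (intro tendsto_mult_right)
    moreover have "g t \<le> g (t / real (Suc n)) / (t / real (Suc n)) * t" for n
    proof -
      have "real (Suc n) * (t / real (Suc n)) = t" and "g x / (t / real (Suc n)) * t = real (Suc n) * g x" for x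
        using \<open>0 < t\<close> by (simp_all add: mult.commute)
      then show ?thesis
        using iterate[of "t / real (Suc n)" "Suc n"] \<open>0 < t\<close> by (simp only: less_imp_le divide_nonneg_nonneg of_nat_0_le_iff)
    qed
    ultimately show ?thesis
      by (intro LIMSEQ_le_const[where X = "\<lambda>n. g (t / real (Suc n)) / (t / real (Suc n)) * t"])
         (auto simp: g_def)
  qed
qed

text \<open>By stationarity the difference quotients of \<open>pmf (P t w) z\<close> at time 0 have
  expectation 0 under \<open>p\<close> for every t > 0. The uniform bound \<open>M\<close> on the
  exit rates dominates them, so the limit t to 0 may be taken inside the expectation.\<close>

lemma stationary_distribution_balance:
  assumes ctmc: "ctmc q P" and stat: "stationary_distribution P p"
    and bounded: "\<And>z. exit_rate q z \<le> M"
  shows "measure_pmf.expectation p (\<lambda>w. if w = z then - exit_rate q z else q w z) = 0"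
proof -
  define t where "t n = 1 / real (Suc n)" for n
  have t_pos: "0 < t n" for n
    by (simp add: t_def)
  have t_lim: "filterlim t (at_right 0) sequentially"
    unfolding t_def by (intro tendsto_imp_filterlim_at_right) real_asymp+
  let ?\<delta> = "\<lambda>w. if w = z then 1 else 0 :: real"
  let ?s = "\<lambda>n w. (pmf (P (t n) w) z - ?\<delta> w) / t n"
  have start: "pmf (P 0 w) z = ?\<delta> w" for w
    using ctmc by (simp add: ctmc_def indicator_def)
  have lim: "(\<lambda>n. ?s n w) \<longlonglongrightarrow> (if w = z then - exit_rate q z else q w z)" for w
  proof -
    have "((\<lambda>t. pmf (P t w) z) has_real_derivative (if w = z then - exit_rate q z else q w z)) (at_right 0)"
      using ctmc by (simp add: ctmc_def exit_rate_def)
    then have "((\<lambda>h. (pmf (P h w) z - ?\<delta> w) / h) \<longlongrightarrow> (if w = z then - exit_rate q z else q w z)) (at_right 0)"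
      unfolding has_field_derivative_iff by (simp only: start diff_0_right)
    from filterlim_compose[OF this t_lim] show ?thesis .
  qed
  have bound: "norm (?s n w) \<le> M" for n w
  proof -
    \<comment> \<open>For \<open>w = z\<close> this is an equality; otherwise being at
      \<open>z\<close> implies not being at \<open>w\<close>.\<close>
    have "\<bar>pmf (P (t n) w) z - ?\<delta> w\<bar> \<le> 1 - pmf (P (t n) w) w"
      using pmf_add_le_one[of w z "P (t n) w"] by (auto simp: pmf_le_1)
    also have "\<dots> \<le> exit_rate q w * t n"
      using t_pos[of n] by (intro ctmc_exit_probability_le[OF ctmc]) simp
    also have "\<dots> \<le> M * t n"
      using t_pos[of n] by (intro mult_right_mono bounded) simp
    finally show ?thesis
      using t_pos[of n] by (simp add: field_simps)
  qed
  have zero: "measure_pmf.expectation p (?s n) = 0" for n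
  proof -
    have "pmf p z = measure_pmf.expectation p (\<lambda>w. pmf (P (t n) w) z)"
      using stat t_pos[of n] by (metis stationary_distribution_def less_imp_le pmf_bind)
    moreover have "measure_pmf.expectation p ?\<delta> = pmf p z"
      by (subst integral_measure_pmf_real[of "{z}"]) (auto split: if_splits)
    moreover have "measure_pmf.expectation p (?s n)
        = (measure_pmf.expectation p (\<lambda>w. pmf (P (t n) w) z) - measure_pmf.expectation p ?\<delta>) / t n"
      by (subst Bochner_Integration.integral_diff[symmetric])
         (auto intro!: measure_pmf.integrable_const_bound[where B = 1] simp: pmf_le_1)
    ultimately show ?thesis
      by simp
  qed
  have "(\<lambda>n. measure_pmf.expectation p (?s n))
      \<longlonglongrightarrow> measure_pmf.expectation p (\<lambda>w. if w = z then - exit_rate q z else q w z)"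
    by (rule integral_dominated_convergence[where w = "\<lambda>_. M"]) (auto simp: lim bound simp del: real_norm_def)
  then show ?thesis
    by (simp only: zero LIMSEQ_const_iff)
qed

section \<open>Stationary distribution of Model 1\<close>

lemma exit_rate_finite:
  assumes "finite S" and "z \<notin> S" and "\<And>z'. z' \<notin> S \<Longrightarrow> z' \<noteq> z \<Longrightarrow> q z z' = 0"
  shows "exit_rate q z = sum (q z) S"
proof -
  have "infsum (q z) (- {z}) = infsum (q z) S"
    by (rule infsum_cong_neutral) (use assms in auto)
  with assms(1) show ?thesis
    by (simp add: exit_rate_def)
qed

lemma status_neq_Up_iff: "\<sigma> \<noteq> Up \<longleftrightarrow> \<sigma> = Down"
  by (cases \<sigma>) auto

lemma exit_rate_rate1:
  "exit_rate (rate1 lam \<mu> \<alpha> \<beta>) (x, Up) = lam + (if x = 0 then 0 else \<mu>) + \<alpha>"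
  "exit_rate (rate1 lam \<mu> \<alpha> \<beta>) (x, Down) = lam + \<beta>"
proof -
  have "exit_rate (rate1 lam \<mu> \<alpha> \<beta>) (0, Up) = lam + \<alpha>"
    by (subst exit_rate_finite[of "{(1, Up), (0, Down)}"])
       (auto simp: status_neq_Up_iff split: if_splits)
  moreover have "exit_rate (rate1 lam \<mu> \<alpha> \<beta>) (Suc y, Up) = lam + \<mu> + \<alpha>" for y
    by (subst exit_rate_finite[of "{(Suc (Suc y), Up), (y, Up), (Suc y, Down)}"])
       (auto simp: status_neq_Up_iff split: if_splits)
  ultimately show "exit_rate (rate1 lam \<mu> \<alpha> \<beta>) (x, Up) = lam + (if x = 0 then 0 else \<mu>) + \<alpha>"
    by (cases x) simp_all
  show "exit_rate (rate1 lam \<mu> \<alpha> \<beta>) (x, Down) = lam + \<beta>"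
    by (subst exit_rate_finite[of "{(Suc x, Down), (x, Up)}"])
       (auto simp: status_neq_Up_iff split: if_splits)
qed

lemma rate1_balance:
  fixes p :: "(nat \<times> status) pmf"
  assumes rates: "0 < lam" "0 < \<mu>" "0 < \<alpha>" "0 < \<beta>"
    and "ctmc (rate1 lam \<mu> \<alpha> \<beta>) P" and "stationary_distribution P p"
  shows "(lam + \<alpha>) * pmf p (0, Up) = \<mu> * pmf p (1, Up) + \<beta> * pmf p (0, Down)"
    and "(lam + \<mu> + \<alpha>) * pmf p (Suc x, Up)
      = lam * pmf p (x, Up) + \<mu> * pmf p (Suc (Suc x), Up) + \<beta> * pmf p (Suc x, Down)"
    and "(lam + \<beta>) * pmf p (0, Down) = \<alpha> * pmf p (0, Up)"
    and "(lam + \<beta>) * pmf p (Suc x, Down) = lam * pmf p (x, Down) + \<alpha> * pmf p (Suc x, Up)"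
proof -
  let ?q = "rate1 lam \<mu> \<alpha> \<beta>"
  have "exit_rate ?q z \<le> lam + \<mu> + \<alpha> + \<beta>" for z
    using rates by (cases z; cases "snd z") (auto simp: exit_rate_rate1)
  note balance = stationary_distribution_balance[OF assms(5,6) this]
  \<comment> \<open>\<open>S\<close> is any finite set that contains \<open>z\<close> and all states
    with a nonzero rate into \<open>z\<close>, so the expectation collapses to a finite sum.\<close>
  have flow: "(\<Sum>w\<in>S. (if w = z then - exit_rate ?q z else ?q w z) * pmf p w) = 0"
    if "finite S" "z \<in> S" "\<And>w. w \<notin> S \<Longrightarrow> ?q w z = 0" for S z
  proof -
    have "(\<Sum>w\<in>S. (if w = z then - exit_rate ?q z else ?q w z) * pmf p w)
        = measure_pmf.expectation p (\<lambda>w. if w = z then - exit_rate ?q z else ?q w z)"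
      by (rule integral_measure_pmf_real[symmetric]) (use that in \<open>auto split: if_splits\<close>)
    with balance show ?thesis
      by simp
  qed
  show "(lam + \<alpha>) * pmf p (0, Up) = \<mu> * pmf p (1, Up) + \<beta> * pmf p (0, Down)"
  proof -
    have "(\<Sum>w\<in>{(0, Up), (1, Up), (0, Down)}. (if w = (0, Up) then - exit_rate ?q (0, Up) else ?q w (0, Up)) * pmf p w) = 0"
      by (rule flow) (auto simp: status_neq_Up_iff split: if_splits)
    then show ?thesis
      by (simp add: exit_rate_rate1 algebra_simps)
  qed
  show "(lam + \<mu> + \<alpha>) * pmf p (Suc x, Up)
      = lam * pmf p (x, Up) + \<mu> * pmf p (Suc (Suc x), Up) + \<beta> * pmf p (Suc x, Down)"
  proof -
    have "(\<Sum>w\<in>{(x, Up), (Suc x, Up), (Suc (Suc x), Up), (Suc x, Down)}. (if w = (Suc x, Up) then - exit_rate ?q (Suc x, Up) else ?q w (Suc x, Up)) * pmf p w) = 0"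
      by (rule flow) (auto simp: status_neq_Up_iff split: if_splits)
    then show ?thesis
      by (simp add: exit_rate_rate1 algebra_simps)
  qed
  show "(lam + \<beta>) * pmf p (0, Down) = \<alpha> * pmf p (0, Up)"
  proof -
    have "(\<Sum>w\<in>{(0, Up), (0, Down)}. (if w = (0, Down) then - exit_rate ?q (0, Down) else ?q w (0, Down)) * pmf p w) = 0"
      by (rule flow) (auto simp: status_neq_Up_iff split: if_splits)
    then show ?thesis
      by (simp add: exit_rate_rate1 algebra_simps)
  qed
  show "(lam + \<beta>) * pmf p (Suc x, Down) = lam * pmf p (x, Down) + \<alpha> * pmf p (Suc x, Up)"
  proof -
    have "(\<Sum>w\<in>{(x, Down), (Suc x, Up), (Suc x, Down)}. (if w = (Suc x, Down) then - exit_rate ?q (Suc x, Down) else ?q w (Suc x, Down)) * pmf p w) = 0"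
      by (rule flow) (auto simp: status_neq_Up_iff split: if_splits)
    then show ?thesis
      by (simp add: exit_rate_rate1 algebra_simps)
  qed
qed

lemma sums_pmf_nat_status:
  fixes p :: "(nat \<times> status) pmf"
  shows "(\<lambda>x. pmf p (x, Up) + pmf p (x, Down)) sums 1"
proof -
  have "pmf (map_pmf fst p) x = pmf p (x, Up) + pmf p (x, Down)" for x
  proof -
    have "fst -` {x} = {(x, Up), (x, Down)}"
      by (auto, metis status.exhaust)
    then show ?thesis
      by (simp add: pmf_map measure_measure_pmf_finite)
  qed
  moreover have "pmf (map_pmf fst p) sums 1"
    using sums_infsetsum_nat'[OF pmf_abs_summable, of "map_pmf fst p"]
    by (simp add: infsetsum_pmf_eq_1)
  ultimately show ?thesis
    by (simp add: sums_def)
qed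

text \<open>The total masses of the two statuses follow from normalisation and from the Down balance
  equations summed over all levels; the summed cut equations then determine the mass at level 0. A
  single Down state is bounded by the total Down mass.\<close>

lemma
  fixes p :: "(nat \<times> status) pmf"
  assumes rates: "0 < lam" "0 < \<mu>" "0 < \<alpha>" "0 < \<beta>"
    and ctmc: "ctmc (rate1 lam \<mu> \<alpha> \<beta>) P" and stat: "stationary_distribution P p"
  shows stationary_Up_0: "pmf p (0, Up) = \<beta> / (\<alpha> + \<beta>) - lam / \<mu>"
    and stationary_Up_Suc: "pmf p (Suc x, Up) = lam / \<mu> * (pmf p (x, Up) + pmf p (x, Down))"
    and stationary_Down_le: "pmf p (x, Down) \<le> \<alpha> / (\<alpha> + \<beta>)"
proof -
  define a where "a x = pmf p (x, Up)" for x
  define d where "d x = pmf p (x, Down)" for x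
  note balance = rate1_balance[OF rates ctmc stat, folded a_def d_def]
  \<comment> \<open>Adding the Up and Down balance equations of one level cancels breakdowns and
    repairs; subtracting the cut equation below that level leaves the one above it.\<close>
  have cut: "\<mu> * a (Suc x) = lam * (a x + d x)" for x
  proof (induction x)
    case 0
    show ?case
      using balance(1) balance(3) by (simp add: algebra_simps)
  next
    case (Suc x)
    then show ?case
      using balance(2)[of x] balance(4)[of x] by (simp add: algebra_simps)
  qed
  have total: "(\<lambda>x. a x + d x) sums 1"
    unfolding a_def d_def by (rule sums_pmf_nat_status)
  have "summable a" "summable d"
    by (rule summable_comparison_test'[OF sums_summable[OF total], of 0]; simp add: a_def d_def)+
  note sum_a = summable_sums[OF \<open>summable a\<close>] and sum_d = summable_sums[OF \<open>summable d\<close>]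
  have one: "suminf a + suminf d = 1"
    using sums_unique2[OF sums_add[OF sum_a sum_d] total] .
  \<comment> \<open>The Down balance is summed over the positive levels in two ways. Together with
    the equation at level 0 this equates the total breakdown and repair flows.\<close>
  have "(\<lambda>x. (lam + \<beta>) * d (Suc x)) sums (lam * suminf d + \<alpha> * (suminf a - a 0))"
    unfolding balance(4) using sum_a sum_d by (intro sums_add sums_mult) (simp_all add: sums_Suc_iff)
  moreover have "(\<lambda>x. (lam + \<beta>) * d (Suc x)) sums ((lam + \<beta>) * (suminf d - d 0))"
    using sum_d by (intro sums_mult) (simp add: sums_Suc_iff)
  ultimately have "lam * suminf d + \<alpha> * (suminf a - a 0) = (lam + \<beta>) * (suminf d - d 0)"
    by (rule sums_unique2)
  with balance(3) have "\<alpha> * suminf a = \<beta> * suminf d"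
    by (simp add: algebra_simps)
  with arg_cong[OF one, of "(*) \<alpha>"] have "\<alpha> = (\<alpha> + \<beta>) * suminf d"
    by (simp add: algebra_simps)
  then have D: "suminf d = \<alpha> / (\<alpha> + \<beta>)"
    using rates by (simp add: field_simps)
  with one have "suminf a = 1 - \<alpha> / (\<alpha> + \<beta>)"
    by simp
  then have A: "suminf a = \<beta> / (\<alpha> + \<beta>)"
    using rates by (simp add: field_simps)
  have "(\<lambda>x. \<mu> * a (Suc x)) sums (\<mu> * (suminf a - a 0))"
    using sum_a by (intro sums_mult) (simp add: sums_Suc_iff)
  moreover have "(\<lambda>x. \<mu> * a (Suc x)) sums (lam * 1)"
    unfolding cut by (intro sums_mult total)
  ultimately have "\<mu> * (suminf a - a 0) = lam * 1"
    by (rule sums_unique2)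
  then have "suminf a - a 0 = lam / \<mu>"
    using rates by (simp add: field_simps)
  then have "a 0 = \<beta> / (\<alpha> + \<beta>) - lam / \<mu>"
    by (simp add: A)
  then show "pmf p (0, Up) = \<beta> / (\<alpha> + \<beta>) - lam / \<mu>"
    by (simp only: a_def)
  show "pmf p (Suc x, Up) = lam / \<mu> * (pmf p (x, Up) + pmf p (x, Down))"
    using cut[of x] rates by (simp add: a_def d_def field_simps)
  have "d x \<le> suminf d"
    using sum_le_suminf[OF \<open>summable d\<close>, of "{x}"] by (simp add: d_def)
  then show "pmf p (x, Down) \<le> \<alpha> / (\<alpha> + \<beta>)"
    by (simp only: D d_def)
qed

section \<open>Taboo probabilities on path space\<close>

text \<open>Only the arrival point is tested against \<open>A\<close>. The chain may thus start
  outside \<open>A\<close>, as it does at level 0, and the condition concerns times from 1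
  on.\<close>

definition taboo_step :: "('s \<Rightarrow> 's pmf) \<Rightarrow> 's set \<Rightarrow> ('s \<Rightarrow> ennreal) \<Rightarrow> 's \<Rightarrow> ennreal" where
  "taboo_step k A f z = (\<integral>\<^sup>+y. indicator A y * f y \<partial>measure_pmf (k z))"

text \<open>Integrating out the last coordinate turns \<open>f\<close> into
  \<open>taboo_step k A f\<close>, which is why the induction needs arbitrary \<open>f\<close>. The
  measure lives on the coordinates 0 to \<open>n\<close>, and the product omits coordinate
  0.\<close>

lemma nn_integral_chain_prefix:
  fixes k :: "'s \<Rightarrow> 's pmf" and f :: "'s \<Rightarrow> ennreal"
  shows "(\<integral>\<^sup>+\<omega>. (\<Prod>i\<in>{1..n}. indicator A (\<omega> i)) * f (\<omega> n)
      \<partial>Ionescu_Tulcea.C (chain_step k z) (\<lambda>_. count_space UNIV) 0 (Suc n) (\<lambda>_. undefined))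
    = (taboo_step k A ^^ n) f z"
proof (induction n arbitrary: f)
  interpret IT: Ionescu_Tulcea "chain_step k z" "\<lambda>_. count_space UNIV"
    by (rule Ionescu_Tulcea_chain)
  have start: "(\<lambda>_. undefined) \<in> space (PiM {0..<0::nat} (\<lambda>_. count_space (UNIV :: 's set)))"
    by (simp add: space_PiM)
  have coord: "(\<lambda>\<omega>. g (\<omega> i)) \<in> borel_measurable (PiM {0..<n} (\<lambda>_. count_space UNIV))"
    if "i < n" for i n :: nat and g :: "'s \<Rightarrow> ennreal"
    by (rule measurable_compose[OF measurable_component_singleton]) (use that in auto)
  have prefix: "(\<lambda>\<omega>. (\<Prod>i\<in>{1..n}. indicator A (\<omega> i)) * g (\<omega> n))
      \<in> borel_measurable (PiM {0..<Suc n} (\<lambda>_. count_space UNIV))" for n and g :: "'s \<Rightarrow> ennreal"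
    by (intro borel_measurable_times_ennreal borel_measurable_prod_ennreal coord) auto
  {
    case 0
    have "(\<integral>\<^sup>+\<omega>. f (\<omega> 0) \<partial>IT.C 0 (Suc 0) (\<lambda>_. undefined)) = (\<integral>\<^sup>+\<omega>. f (\<omega> 0) \<partial>IT.eP 0 (\<lambda>_. undefined))"
      using start IT.measurable_eP[of 0] by (simp add: bind_return)
    also have "\<dots> = f z"
      by (subst IT.nn_integral_eP[OF start]) (use coord[of 0 1 f] in auto)
    finally show ?case
      by simp
  next
    case (Suc n)
    have space: "space (IT.C 0 (Suc n) (\<lambda>_. undefined)) = space (PiM {0..<Suc n} (\<lambda>_. count_space UNIV))"
      using IT.space_C[OF start, of "Suc n"] by simp
    have meas: "IT.eP (Suc n) \<in> IT.C 0 (Suc n) (\<lambda>_. undefined)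
        \<rightarrow>\<^sub>M subprob_algebra (PiM {0..<Suc (Suc n)} (\<lambda>_. count_space UNIV))"
      using IT.measurable_eP[of "Suc n"]
      by (simp only: measurable_cong_sets[OF IT.sets_C[OF start, of "Suc n"] refl] add_0)
    have "(\<integral>\<^sup>+\<omega>. (\<Prod>i\<in>{1..Suc n}. indicator A (\<omega> i)) * f (\<omega> (Suc n))
          \<partial>IT.C 0 (Suc (Suc n)) (\<lambda>_. undefined))
        = (\<integral>\<^sup>+\<omega>. \<integral>\<^sup>+\<omega>'. (\<Prod>i\<in>{1..Suc n}. indicator A (\<omega>' i)) * f (\<omega>' (Suc n)) \<partial>IT.eP (Suc n) \<omega>
          \<partial>IT.C 0 (Suc n) (\<lambda>_. undefined))"
      by (subst IT.C.simps(2), subst nn_integral_bind[OF prefix]) (use meas in simp_all)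
    also have "\<dots> = (\<integral>\<^sup>+\<omega>. (\<Prod>i\<in>{1..n}. indicator A (\<omega> i)) * taboo_step k A f (\<omega> n)
          \<partial>IT.C 0 (Suc n) (\<lambda>_. undefined))"
    proof (rule nn_integral_cong)
      fix \<omega> assume "\<omega> \<in> space (IT.C 0 (Suc n) (\<lambda>_. undefined))"
      then have \<omega>: "\<omega> \<in> space (PiM {0..<Suc n} (\<lambda>_. count_space UNIV))"
        by (simp only: space)
      \<comment> \<open>\<open>IT.eP (Suc n) \<omega>\<close> appends one coordinate
        \<open>y\<close> to the prefix and leaves the earlier factors unchanged.\<close>
      have "(\<Prod>i\<in>{1..Suc n}. indicator A ((fun_upd \<omega> (Suc n) y) i)) * f ((fun_upd \<omega> (Suc n) y) (Suc n))
          = (\<Prod>i\<in>{1..n}. indicator A (\<omega> i)) * (indicator A y * f y)" for y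
        by (simp add: mult.assoc mult.commute)
      then show "(\<integral>\<^sup>+\<omega>'. (\<Prod>i\<in>{1..Suc n}. indicator A (\<omega>' i)) * f (\<omega>' (Suc n)) \<partial>IT.eP (Suc n) \<omega>)
          = (\<Prod>i\<in>{1..n}. indicator A (\<omega> i)) * taboo_step k A f (\<omega> n)"
        by (subst IT.nn_integral_eP[OF \<omega> prefix]) (simp add: taboo_step_def nn_integral_cmult)
    qed
    also have "\<dots> = (taboo_step k A ^^ Suc n) f z"
      by (subst Suc) (simp add: funpow_swap1)
    finally show ?case .
  }
qed

lemma sets_chain_paths: "sets (chain_paths k z) = sets (PiM UNIV (\<lambda>_. count_space UNIV))"
proof -
  interpret IT: Ionescu_Tulcea "chain_step k z" "\<lambda>_. count_space UNIV"
    by (rule Ionescu_Tulcea_chain)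
  show ?thesis
    unfolding chain_paths_def by (rule IT.PF.sets_lim)
qed

text \<open>The event is a cylinder over the coordinates 0 to \<open>n\<close>, so its measure is
  that of its base under the finite-dimensional law, and the indicator of the base is a product of
  indicators.\<close>

lemma emeasure_chain_paths_prefix:
  "emeasure (chain_paths k z) {\<omega>. \<forall>i\<in>{1..n}. \<omega> i \<in> A} = (taboo_step k A ^^ n) (\<lambda>_. 1) z"
proof -
  interpret IT: Ionescu_Tulcea "chain_step k z" "\<lambda>_. count_space UNIV"
    by (rule Ionescu_Tulcea_chain)
  \<comment> \<open>The factor \<open>UNIV\<close> leaves the starting state unconstrained.\<close>
  let ?X = "PiE {0..<Suc n} (\<lambda>i. if i = 0 then UNIV else A)"
  have X: "?X \<in> sets (PiM {0..<Suc n} (\<lambda>_. count_space UNIV))"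
    by (rule sets_PiM_I_finite) auto
  have sets: "sets (IT.C 0 (Suc n) (\<lambda>_. undefined)) = sets (PiM {0..<Suc n} (\<lambda>_. count_space UNIV))"
    using IT.sets_C[of "\<lambda>_. undefined" 0 "Suc n"] by (simp add: space_PiM)
  have "(\<forall>i\<in>{1..n}. \<omega> i \<in> A) \<longleftrightarrow> (\<forall>i\<in>{0..<Suc n}. \<omega> i \<in> (if i = 0 then UNIV else A))" for \<omega>
  proof
    assume "\<forall>i\<in>{1..n}. \<omega> i \<in> A"
    then show "\<forall>i\<in>{0..<Suc n}. \<omega> i \<in> (if i = 0 then UNIV else A)"
      by auto
  next
    assume *: "\<forall>i\<in>{0..<Suc n}. \<omega> i \<in> (if i = 0 then UNIV else A)"
    show "\<forall>i\<in>{1..n}. \<omega> i \<in> A"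
    proof
      fix i assume "i \<in> {1..n}"
      then show "\<omega> i \<in> A"
        using bspec[OF *, of i] by simp
    qed
  qed
  then have "{\<omega>. \<forall>i\<in>{1..n}. \<omega> i \<in> A} = IT.PF.emb UNIV {0..<Suc n} ?X"
    by (simp only: set_eq_iff prod_emb_iff mem_Collect_eq restrict_PiE_iff) (simp add: extensional_def)
  then have "emeasure (chain_paths k z) {\<omega>. \<forall>i\<in>{1..n}. \<omega> i \<in> A} = emeasure (IT.CI {0..<Suc n}) ?X"
    unfolding chain_paths_def using IT.lim[OF _ X] by simp
  also have "\<dots> = emeasure (IT.C 0 (Suc n) (\<lambda>_. undefined)) ?X"
    using IT.emeasure_CI[OF order_refl X] prod_emb_id[OF sets.sets_into_space[OF X, unfolded space_PiM]]
    by simp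
  also have "\<dots> = (\<integral>\<^sup>+\<omega>. (\<Prod>i\<in>{1..n}. indicator A (\<omega> i)) * 1 \<partial>IT.C 0 (Suc n) (\<lambda>_. undefined))"
  proof (subst nn_integral_indicator[symmetric])
    show "?X \<in> sets (IT.C 0 (Suc n) (\<lambda>_. undefined))"
      using X sets by simp
    show "(\<integral>\<^sup>+\<omega>. indicator ?X \<omega> \<partial>IT.C 0 (Suc n) (\<lambda>_. undefined))
        = (\<integral>\<^sup>+\<omega>. (\<Prod>i\<in>{1..n}. indicator A (\<omega> i)) * 1 \<partial>IT.C 0 (Suc n) (\<lambda>_. undefined))"
    proof (rule nn_integral_cong)
      fix \<omega> assume "\<omega> \<in> space (IT.C 0 (Suc n) (\<lambda>_. undefined))"
      then have "\<omega> \<in> extensional {0..<Suc n}"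
        using sets_eq_imp_space_eq[OF sets] by (simp add: space_PiM PiE_iff)
      then show "indicator ?X \<omega> = (\<Prod>i\<in>{1..n}. indicator A (\<omega> i)) * (1::ennreal)"
        by (auto simp: indicator_def PiE_iff Ball_def intro!: prod_zero)
    qed
  qed
  also have "\<dots> = (taboo_step k A ^^ n) (\<lambda>_. 1) z"
    by (rule nn_integral_chain_prefix)
  finally show ?thesis .
qed

text \<open>For \<open>n = 0\<close> the prefix event is the whole path space.\<close>

lemma prob_space_chain_paths: "prob_space (chain_paths k z)"
  using emeasure_chain_paths_prefix[of k z 0] sets_eq_imp_space_eq[OF sets_chain_paths[of k z]]
  by (intro prob_spaceI) (simp add: space_PiM)

text \<open>Continuity from above along the decreasing events that the first \<open>n\<close> steps
  stay in \<open>A\<close>.\<close>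

lemma taboo_step_pow_tendsto:
  fixes k :: "'s \<Rightarrow> 's pmf"
  shows "(\<lambda>n. (taboo_step k A ^^ n) (\<lambda>_. 1) z) \<longlonglongrightarrow> emeasure (chain_paths k z) {\<omega>. \<forall>n\<ge>1. \<omega> n \<in> A}"
proof -
  interpret prob_space "chain_paths k z"
    by (rule prob_space_chain_paths)
  let ?B = "\<lambda>n. {\<omega> :: nat \<Rightarrow> 's. \<forall>i\<in>{1..n}. \<omega> i \<in> A}"
  have meas: "?B n \<in> sets (chain_paths k z)" for n
  proof -
    have "?B n = prod_emb UNIV (\<lambda>_. count_space UNIV) {1..n} (PiE {1..n} (\<lambda>_. A))"
      by (auto simp: prod_emb_def PiE_iff extensional_def)
    then show ?thesis
      unfolding sets_chain_paths by (simp add: sets_PiM_I)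
  qed
  have "(\<lambda>n. emeasure (chain_paths k z) (?B n)) \<longlonglongrightarrow> emeasure (chain_paths k z) (\<Inter>n. ?B n)"
    using meas by (intro Lim_emeasure_decseq) (auto simp: decseq_def)
  moreover have "(\<Inter>n. ?B n) = {\<omega>. \<forall>n\<ge>1. \<omega> n \<in> A}"
  proof (intro equalityI subsetI CollectI allI impI)
    fix \<omega> and n :: nat assume "\<omega> \<in> (\<Inter>n. ?B n)" "1 \<le> n"
    then have "\<omega> \<in> ?B n" "n \<in> {1..n}"
      by auto
    then show "\<omega> n \<in> A"
      by blast
  qed auto
  ultimately show ?thesis
    by (simp only: emeasure_chain_paths_prefix)
qed

section \<open>Survival of the twisted chain\<close>

text \<open>The last three assumptions are stated directly on the constants; for small
  \<open>\<alpha>\<close> they follow from the limits of \<open>gamma1\<close> and of the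
  denominator.\<close>

locale twisted_model1 =
  fixes lam \<mu> \<alpha> \<beta> C :: real
  assumes rates_pos: "0 < lam" "0 < \<mu>" "0 < \<alpha>" "0 < \<beta>"
    and C_ge: "lam + \<mu> + \<alpha> + \<beta> \<le> C"
    and denom_pos: "0 < lam + \<beta> - \<mu> - \<alpha> + sqrt (s1 lam \<mu> \<alpha> \<beta>)"
    and gamma_pos: "0 < gamma1 lam \<mu> \<alpha> \<beta>"
    and gamma_less_one: "gamma1 lam \<mu> \<alpha> \<beta> < 1"
begin

abbreviation \<gamma> where "\<gamma> \<equiv> gamma1 lam \<mu> \<alpha> \<beta>"
text \<open>The ratio of \<open>h1\<close> at Down to \<open>h1\<close> at Up, the same at every
  level.\<close>

definition r where "r = 2 * \<beta> / (lam + \<beta> - \<mu> - \<alpha> + sqrt (s1 lam \<mu> \<alpha> \<beta>))"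
abbreviation step where "step \<equiv> twisted_step C lam \<mu> \<alpha> \<beta>"
abbreviation stay where "stay \<equiv> stay_positive_prob C lam \<mu> \<alpha> \<beta>"

lemma C_pos: "0 < C"
  using rates_pos C_ge by linarith

lemma r_pos: "0 < r"
  using rates_pos denom_pos by (simp add: r_def)

section \<open>Harmonicity of \<open>h1\<close>\<close>

lemma lam_div_gamma: "lam / \<gamma> = (lam + \<beta> + \<mu> + \<alpha> - sqrt (s1 lam \<mu> \<alpha> \<beta>)) / 2"
  using rates_pos by (simp add: gamma1_def)

lemma harmonic_Down: "lam / \<gamma> + \<beta> / r = lam + \<beta>"
  using rates_pos unfolding lam_div_gamma r_def by (simp add: field_simps)

text \<open>The number \<open>y = lam / \<gamma>\<close> is a root of a quadratic, obtained by
  squaring the formula for \<open>sqrt (s1 lam \<mu> \<alpha> \<beta>)\<close>. Once denominators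
  are cleared, the claim follows from that quadratic.\<close>

lemma harmonic_Up: "lam / \<gamma> + \<mu> * \<gamma> + \<alpha> * r = lam + \<mu> + \<alpha>"
proof -
  define y where "y = lam / \<gamma>"
  have "0 < y"
    using rates_pos gamma_pos by (simp add: y_def)
  have gamma: "\<gamma> = lam / y"
    using rates_pos by (simp add: y_def)
  have y: "sqrt (s1 lam \<mu> \<alpha> \<beta>) = lam + \<beta> + \<mu> + \<alpha> - 2 * y"
    unfolding y_def lam_div_gamma by (simp add: field_simps)
  have "y < lam + \<beta>"
    using denom_pos unfolding y by simp
  have "0 \<le> s1 lam \<mu> \<alpha> \<beta>"
    using rates_pos by (simp add: s1_def)
  then have "s1 lam \<mu> \<alpha> \<beta> = (lam + \<beta> + \<mu> + \<alpha> - 2 * y)\<^sup>2"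
    unfolding y[symmetric] by simp
  then have quad: "y\<^sup>2 + \<mu> * (lam + \<beta>) = (lam + \<mu> + \<alpha> + \<beta>) * y"
    unfolding s1_def by algebra
  \<comment> \<open>Half of the denominator of \<open>r\<close>, expressed through
    \<open>y\<close>.\<close>
  define w where "w = lam + \<beta> - y"
  have "0 < w"
    using \<open>y < lam + \<beta>\<close> by (simp add: w_def)
  have r: "r = \<beta> / w"
    unfolding r_def y w_def using \<open>y < lam + \<beta>\<close> by (simp add: divide_simps)
  have "(y + \<mu> * lam / y + \<alpha> * \<beta> / w) * (y * w) = (y\<^sup>2 + \<mu> * lam) * w + \<alpha> * \<beta> * y"
    using \<open>0 < y\<close> \<open>0 < w\<close> by (simp add: field_simps power2_eq_square)
  also have "\<dots> = (lam + \<mu> + \<alpha>) * (y * w)"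
    using quad unfolding w_def by algebra
  finally have "y + \<mu> * lam / y + \<alpha> * \<beta> / w = lam + \<mu> + \<alpha>"
    using \<open>0 < y\<close> \<open>0 < w\<close> by simp
  then show ?thesis
    unfolding r using rates_pos by (simp add: gamma)
qed

section \<open>The one-step operator of the twisted chain\<close>

fun transition :: "(int \<times> status \<Rightarrow> real) \<Rightarrow> int \<times> status \<Rightarrow> real" where
  "transition f (m, Up) = lam / (\<gamma> * C) * f (m + 1, Up) + \<mu> * \<gamma> / C * f (m - 1, Up)
     + \<alpha> * r / C * f (m, Down) + (1 - (lam + \<mu> + \<alpha>) / C) * f (m, Up)"
| "transition f (m, Down) = lam / (\<gamma> * C) * f (m + 1, Down)
     + \<beta> / (r * C) * f (m, Up) + (1 - (lam + \<beta>) / C) * f (m, Down)"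

lemma weights_nonneg:
  "0 < lam / (\<gamma> * C)" "0 \<le> \<mu> * \<gamma> / C" "0 \<le> \<alpha> * r / C" "0 \<le> \<beta> / (r * C)"
  "0 \<le> 1 - (lam + \<mu> + \<alpha>) / C" "0 \<le> 1 - (lam + \<beta>) / C"
  using rates_pos C_ge C_pos gamma_pos r_pos by simp_all

text \<open>The two harmonicity identities divided by \<open>C\<close>.\<close>

lemma weights_sum:
  "lam / (\<gamma> * C) + \<mu> * \<gamma> / C + \<alpha> * r / C + (1 - (lam + \<mu> + \<alpha>) / C) = 1"
  "lam / (\<gamma> * C) + \<beta> / (r * C) + (1 - (lam + \<beta>) / C) = 1"
proof -
  have "(lam / \<gamma> + \<mu> * \<gamma> + \<alpha> * r) / C = (lam + \<mu> + \<alpha>) / C" "(lam / \<gamma> + \<beta> / r) / C = (lam + \<beta>) / C"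
    by (simp_all only: harmonic_Up harmonic_Down)
  then show "lam / (\<gamma> * C) + \<mu> * \<gamma> / C + \<alpha> * r / C + (1 - (lam + \<mu> + \<alpha>) / C) = 1"
    "lam / (\<gamma> * C) + \<beta> / (r * C) + (1 - (lam + \<beta>) / C) = 1"
    by (simp_all only: add_divide_distrib divide_divide_eq_left)
qed

lemma twisted_kernel_simps:
  "twisted_kernel C lam \<mu> \<alpha> \<beta> (m, Up) (m + 1, Up) = lam / (\<gamma> * C)"
  "twisted_kernel C lam \<mu> \<alpha> \<beta> (m, Up) (m - 1, Up) = \<mu> * \<gamma> / C"
  "twisted_kernel C lam \<mu> \<alpha> \<beta> (m, Up) (m, Down) = \<alpha> * r / C"
  "twisted_kernel C lam \<mu> \<alpha> \<beta> (m, Up) (m, Up) = 1 - (lam + \<mu> + \<alpha>) / C"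
  "twisted_kernel C lam \<mu> \<alpha> \<beta> (m, Down) (m + 1, Down) = lam / (\<gamma> * C)"
  "twisted_kernel C lam \<mu> \<alpha> \<beta> (m, Down) (m, Up) = \<beta> / (r * C)"
  "twisted_kernel C lam \<mu> \<alpha> \<beta> (m, Down) (m, Down) = 1 - (lam + \<beta>) / C"
proof -
  have up: "\<gamma> powi - (m + 1) = \<gamma> powi - m / \<gamma>" and down: "\<gamma> powi - (m - 1) = \<gamma> powi - m * \<gamma>"
    using power_int_diff[of \<gamma> "- m" 1] power_int_add[of \<gamma> "- m" 1] gamma_pos by simp_all
  have nz: "\<gamma> \<noteq> 0" "\<gamma> powi - m \<noteq> 0" "r \<noteq> 0"
    using gamma_pos r_pos by simp_all
  show
    "twisted_kernel C lam \<mu> \<alpha> \<beta> (m, Up) (m + 1, Up) = lam / (\<gamma> * C)"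
    "twisted_kernel C lam \<mu> \<alpha> \<beta> (m, Up) (m - 1, Up) = \<mu> * \<gamma> / C"
    "twisted_kernel C lam \<mu> \<alpha> \<beta> (m, Up) (m, Down) = \<alpha> * r / C"
    "twisted_kernel C lam \<mu> \<alpha> \<beta> (m, Up) (m, Up) = 1 - (lam + \<mu> + \<alpha>) / C"
    "twisted_kernel C lam \<mu> \<alpha> \<beta> (m, Down) (m + 1, Down) = lam / (\<gamma> * C)"
    "twisted_kernel C lam \<mu> \<alpha> \<beta> (m, Down) (m, Up) = \<beta> / (r * C)"
    "twisted_kernel C lam \<mu> \<alpha> \<beta> (m, Down) (m, Down) = 1 - (lam + \<beta>) / C"
    unfolding twisted_kernel_def free_kernel.simps h1.simps up down r_def[symmetric] using nz
    by (simp_all del: power_int_minus)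
qed

fun nbrs :: "int \<times> status \<Rightarrow> (int \<times> status) set" where
  "nbrs (m, Up) = {(m + 1, Up), (m - 1, Up), (m, Down), (m, Up)}"
| "nbrs (m, Down) = {(m + 1, Down), (m, Up), (m, Down)}"

lemma finite_nbrs: "finite (nbrs z)"
  by (cases z rule: nbrs.cases) simp_all

lemma twisted_kernel_eq_0:
  assumes "z' \<notin> nbrs z"
  shows "twisted_kernel C lam \<mu> \<alpha> \<beta> z z' = 0"
proof -
  have "free_kernel C lam \<mu> \<alpha> \<beta> z z' = 0"
    using assms by (cases z rule: nbrs.cases; cases z'; cases "snd z'") auto
  then show ?thesis
    by (simp add: twisted_kernel_def)
qed

text \<open>Linearity, positivity and limits of \<open>transition\<close> are read off this finite
  weighted sum.\<close>

lemma sum_twisted_kernel: "(\<Sum>z'\<in>nbrs z. f z' * twisted_kernel C lam \<mu> \<alpha> \<beta> z z') = transition f z"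
  by (cases z rule: nbrs.cases) (simp_all add: twisted_kernel_simps algebra_simps)

lemma twisted_kernel_nonneg: "0 \<le> twisted_kernel C lam \<mu> \<alpha> \<beta> z z'"
proof (cases "z' \<in> nbrs z")
  case True
  then show ?thesis
    using weights_nonneg
    by (cases z rule: nbrs.cases) (auto simp: twisted_kernel_simps less_imp_le simp del: diff_ge_0_iff_ge)
qed (simp add: twisted_kernel_eq_0)

lemma transition_const: "transition (\<lambda>_. c) z = c"
  by (cases z rule: nbrs.cases) (simp_all only: transition.simps flip: distrib_right, simp_all only: weights_sum mult_1)

text \<open>\<open>embed_pmf\<close> is determined only for a nonnegative function of total mass 1.
  The support is finite, so the mass is \<open>transition\<close> applied to the constant 1.\<close>

lemma pmf_twisted_step: "pmf (step z) z' = twisted_kernel C lam \<mu> \<alpha> \<beta> z z'"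
proof -
  have "(\<integral>\<^sup>+z'. ennreal (twisted_kernel C lam \<mu> \<alpha> \<beta> z z') \<partial>count_space UNIV)
      = (\<Sum>z'\<in>nbrs z. ennreal (twisted_kernel C lam \<mu> \<alpha> \<beta> z z'))"
    by (rule nn_integral_count_space') (auto simp: finite_nbrs twisted_kernel_eq_0)
  also have "\<dots> = ennreal (\<Sum>z'\<in>nbrs z. 1 * twisted_kernel C lam \<mu> \<alpha> \<beta> z z')"
    by (simp add: sum_ennreal twisted_kernel_nonneg)
  also have "\<dots> = 1"
    unfolding sum_twisted_kernel transition_const by simp
  finally show ?thesis
    unfolding twisted_step_def by (intro pmf_embed_pmf twisted_kernel_nonneg)
qed

lemma nn_integral_twisted_step:
  assumes "\<And>z. 0 \<le> f z"
  shows "(\<integral>\<^sup>+z'. ennreal (f z') \<partial>measure_pmf (step z)) = ennreal (transition f z)"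
proof -
  have "set_pmf (step z) \<subseteq> nbrs z"
    by (auto simp: set_pmf_iff pmf_twisted_step dest: contrapos_np[OF _ twisted_kernel_eq_0])
  then have "(\<integral>\<^sup>+z'. ennreal (f z') \<partial>measure_pmf (step z))
      = (\<Sum>z'\<in>nbrs z. ennreal (f z') * ennreal (pmf (step z) z'))"
    by (intro nn_integral_measure_pmf_support finite_nbrs) auto
  also have "\<dots> = ennreal (\<Sum>z'\<in>nbrs z. f z' * twisted_kernel C lam \<mu> \<alpha> \<beta> z z')"
    using assms by (simp add: sum_ennreal twisted_kernel_nonneg pmf_twisted_step flip: ennreal_mult)
  finally show ?thesis
    unfolding sum_twisted_kernel .
qed

lemma transition_nonneg: "(\<And>z. 0 \<le> f z) \<Longrightarrow> 0 \<le> transition f z"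
  unfolding sum_twisted_kernel[symmetric] by (intro sum_nonneg mult_nonneg_nonneg twisted_kernel_nonneg)

section \<open>Survival probabilities as limits of killed iterates\<close>

definition killed :: "(int \<times> status \<Rightarrow> real) \<Rightarrow> int \<times> status \<Rightarrow> real" where
  "killed f z = (if 0 < fst z then f z else 0)"

lemma killed_simps:
  "0 < m \<Longrightarrow> killed f (m, \<sigma>) = f (m, \<sigma>)"
  "m \<le> 0 \<Longrightarrow> killed f (m, \<sigma>) = 0"
  by (simp_all add: killed_def)

abbreviation survival :: "nat \<Rightarrow> int \<times> status \<Rightarrow> real" where
  "survival n \<equiv> ((\<lambda>f. transition (killed f)) ^^ n) (\<lambda>_. 1)"

lemma survival_nonneg: "0 \<le> survival n z"
  by (induction n arbitrary: z) (auto simp: killed_def intro!: transition_nonneg)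

text \<open>Carries the extended nonnegative path-space recursion over to real-valued functions,
  where differences can be formed.\<close>

lemma taboo_step_eq_survival:
  "(taboo_step step {z. 0 < fst z} ^^ n) (\<lambda>_. 1) z = ennreal (survival n z)"
proof (induction n arbitrary: z)
  case (Suc n)
  have "(taboo_step step {z. 0 < fst z} ^^ n) (\<lambda>_. 1) = (\<lambda>z. ennreal (survival n z))"
    by (rule ext) (rule Suc.IH)
  then have "(taboo_step step {z. 0 < fst z} ^^ Suc n) (\<lambda>_. 1) z
      = taboo_step step {z. 0 < fst z} (\<lambda>z. ennreal (survival n z)) z"
    by simp
  also have "\<dots> = (\<integral>\<^sup>+z'. ennreal (killed (survival n) z') \<partial>measure_pmf (step z))"
    unfolding taboo_step_def killed_def by (intro nn_integral_cong) (simp split: split_indicator)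
  also have "\<dots> = ennreal (survival (Suc n) z)"
    by (subst nn_integral_twisted_step) (simp_all add: killed_def survival_nonneg)
  finally show ?case .
qed simp

lemma stay_le_one: "stay z \<le> 1" and stay_nonneg: "0 \<le> stay z"
  unfolding stay_positive_prob_def by (simp_all add: prob_space.prob_le_1[OF prob_space_chain_paths])

lemma survival_tendsto: "(\<lambda>n. survival n z) \<longlonglongrightarrow> stay z"
proof -
  interpret prob_space "chain_paths step z"
    by (rule prob_space_chain_paths)
  have "emeasure (chain_paths step z) {\<omega>. \<forall>n\<ge>1. \<omega> n \<in> {z. 0 < fst z}} = ennreal (stay z)"
    by (simp add: emeasure_eq_measure stay_positive_prob_def)
  with taboo_step_pow_tendsto[of step "{z. 0 < fst z}" z]
  have "(\<lambda>n. ennreal (survival n z)) \<longlonglongrightarrow> ennreal (stay z)"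
    by (simp only: taboo_step_eq_survival)
  from tendsto_enn2real[OF this stay_nonneg] show ?thesis
    by (simp only: enn2real_ennreal[OF survival_nonneg])
qed

text \<open>The limit of the recursion defining \<open>survival\<close>; it passes through
  \<open>transition\<close> because that is a finite sum.\<close>

lemma stay_first_step: "stay z = transition (killed stay) z"
proof (rule LIMSEQ_unique)
  show "(\<lambda>n. survival (Suc n) z) \<longlonglongrightarrow> stay z"
    using survival_tendsto by (rule LIMSEQ_Suc)
  have "(\<lambda>n. killed (survival n) z) \<longlonglongrightarrow> killed stay z" for z
    by (simp add: killed_def survival_tendsto)
  then show "(\<lambda>n. survival (Suc n) z) \<longlonglongrightarrow> transition (killed stay) z"
    unfolding sum_twisted_kernel[symmetric] funpow.simps comp_def
    by (intro tendsto_sum tendsto_mult_right)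
qed

section \<open>The survival probability from a positive level\<close>

fun recip_h :: "int \<times> status \<Rightarrow> real" where
  "recip_h (m, Up) = \<gamma> powi m"
| "recip_h (m, Down) = \<gamma> powi m / r"

text \<open>The factor \<open>h1 z' / h1 z\<close> of the twisted kernel cancels against
  \<open>recip_h\<close>, leaving a row sum of the free kernel, which is 1.\<close>

lemma transition_recip_h: "transition recip_h z = recip_h z"
proof -
  have shift: "\<gamma> powi (m + 1) = \<gamma> powi m * \<gamma>" "\<gamma> powi (m - 1) = \<gamma> powi m / \<gamma>" for m
    using power_int_diff[of \<gamma> m 1] power_int_add[of \<gamma> m 1] gamma_pos by simp_all
  show ?thesis
    using gamma_pos r_pos C_pos
    by (cases z rule: nbrs.cases) (simp_all add: shift field_simps)
qed

lemma transition_diff: "transition (\<lambda>z. f z - g z) z = transition f z - transition g z"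
  unfolding sum_twisted_kernel[symmetric] by (simp add: algebra_simps sum_subtractf)

text \<open>From a positive level the chain can reach level 0 only through \<open>(0, Up)\<close>.\<close>

lemma transition_mono_pos:
  assumes "0 < m" and "\<And>m \<sigma>. 0 < m \<Longrightarrow> f (m, \<sigma>) \<le> g (m, \<sigma>)" and "f (0, Up) \<le> g (0, Up)"
  shows "transition f (m, \<sigma>) \<le> transition g (m, \<sigma>)"
proof -
  have "f (m - 1, Up) \<le> g (m - 1, Up)"
    using assms by (cases "m = 1") auto
  moreover have "f (m + 1, \<tau>) \<le> g (m + 1, \<tau>)" "f (m, \<tau>) \<le> g (m, \<tau>)" for \<tau>
    using assms by simp_all
  ultimately show ?thesis
    by (cases \<sigma>; simp only: transition.simps)
       (intro add_mono mult_left_mono weights_nonneg(2-) less_imp_le[OF weights_nonneg(1)]; simp)+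
qed

text \<open>The harmonic function \<open>1 - recip_h\<close> lies below 1 and vanishes at
  \<open>(0, Up)\<close>, where killing takes place. Hence the comparison survives each killed
  step.\<close>

lemma survival_ge: "0 < m \<Longrightarrow> 1 - recip_h (m, \<sigma>) \<le> survival n (m, \<sigma>)"
proof (induction n arbitrary: m \<sigma>)
  case 0
  show ?case
    using gamma_pos r_pos by (cases \<sigma>) simp_all
next
  case (Suc n)
  have "1 - recip_h (m, \<sigma>) = transition (\<lambda>z. 1 - recip_h z) (m, \<sigma>)"
    unfolding transition_diff transition_const transition_recip_h ..
  also have "\<dots> \<le> transition (killed (survival n)) (m, \<sigma>)"
    using Suc by (intro transition_mono_pos) (simp_all add: killed_simps)
  finally show ?case
    by simp
qed

lemma stay_ge: "0 < m \<Longrightarrow> 1 - recip_h (m, \<sigma>) \<le> stay (m, \<sigma>)"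
  by (rule LIMSEQ_le_const[OF survival_tendsto]) (simp add: survival_ge)

text \<open>On the strip \<open>0 < m \<le> N\<close> the chain leaves through the top with probability at least \<open>\<delta> ^ N\<close>,
  where \<open>\<delta>\<close> is the probability of an upward step, so every bound \<open>M\<close> improves to
  \<open>(1 - \<delta> ^ N) * M\<close>.\<close>

lemma maximum_principle:
  assumes harmonic: "\<And>m \<sigma>. 0 < m \<Longrightarrow> m < int N \<Longrightarrow> f (m, \<sigma>) \<le> transition f (m, \<sigma>)"
    and top: "\<And>\<sigma>. f (int N, \<sigma>) \<le> 0" and bottom: "f (0, Up) \<le> 0"
    and bounded: "\<And>m \<sigma>. 0 < m \<Longrightarrow> m \<le> int N \<Longrightarrow> f (m, \<sigma>) \<le> K" and "0 \<le> K"
    and "0 < m" "m \<le> int N"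
  shows "f (m, \<sigma>) \<le> 0"
proof -
  define \<delta> where "\<delta> = lam / (\<gamma> * C)"
  have \<delta>: "0 < \<delta>" "\<delta> \<le> 1"
    using weights_nonneg weights_sum(2) unfolding \<delta>_def by linarith+
  have improve: "f (m, \<sigma>) \<le> (1 - \<delta> ^ N) * M"
    if M: "0 \<le> M" "\<And>m \<sigma>. 0 < m \<Longrightarrow> m \<le> int N \<Longrightarrow> f (m, \<sigma>) \<le> M" and "0 < m" "m \<le> int N" for M m \<sigma>
  proof -
    \<comment> \<open>Induction downwards from the top: \<open>j\<close> levels below it, an upward
      step of weight \<open>\<delta>\<close> leads to the improved bound for \<open>j - 1\<close>,
      and all other moves are bounded by \<open>M\<close>.\<close>
    have ladder: "f (int N - int j, \<sigma>) \<le> (1 - \<delta> ^ j) * M" if "j < N" for j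
      using that
    proof (induction j)
      case 0
      with top show ?case by simp
    next
      case (Suc j)
      define i where "i = int N - int (Suc j)"
      have i: "0 < i" "i < int N" "int N - int j = i + 1"
        using Suc.prems by (auto simp: i_def)
      have up: "f (i + 1, \<sigma>) \<le> (1 - \<delta> ^ j) * M"
        using Suc by (simp flip: i(3))
      \<comment> \<open>From level 1 the downward step lands on \<open>(0, Up)\<close>, where
        \<open>f\<close> is at most 0 and hence at most \<open>M\<close>.\<close>
      have down: "f (i - 1, Up) \<le> M"
        using M(2)[of "i - 1" Up] bottom M(1) i(1,2) by (cases "i = 1") auto
      have same: "f (i, \<tau>) \<le> M" for \<tau>
        using M(2) i by simp
      have "f (i, \<sigma>) \<le> transition f (i, \<sigma>)"
        using harmonic i by simp
      also have "\<dots> \<le> \<delta> * ((1 - \<delta> ^ j) * M) + (1 - \<delta>) * M"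
      proof (cases \<sigma>)
        case Up
        have "transition f (i, \<sigma>) \<le> \<delta> * ((1 - \<delta> ^ j) * M) + \<mu> * \<gamma> / C * M + \<alpha> * r / C * M
            + (1 - (lam + \<mu> + \<alpha>) / C) * M"
          unfolding Up transition.simps \<delta>_def[symmetric] using up down same weights_nonneg \<delta> Up
          by (intro add_mono mult_left_mono) auto
        also have "\<dots> = \<delta> * ((1 - \<delta> ^ j) * M) + (\<mu> * \<gamma> / C + \<alpha> * r / C + (1 - (lam + \<mu> + \<alpha>) / C)) * M"
          by (simp only: distrib_right add.assoc)
        also have "\<mu> * \<gamma> / C + \<alpha> * r / C + (1 - (lam + \<mu> + \<alpha>) / C) = 1 - \<delta>"
          using weights_sum(1) unfolding \<delta>_def by linarith
        finally show ?thesis .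
      next
        case Down
        have "transition f (i, \<sigma>) \<le> \<delta> * ((1 - \<delta> ^ j) * M) + \<beta> / (r * C) * M + (1 - (lam + \<beta>) / C) * M"
          unfolding Down transition.simps \<delta>_def[symmetric] using up same weights_nonneg \<delta> Down
          by (intro add_mono mult_left_mono) auto
        also have "\<dots> = \<delta> * ((1 - \<delta> ^ j) * M) + (\<beta> / (r * C) + (1 - (lam + \<beta>) / C)) * M"
          by (simp only: distrib_right add.assoc)
        also have "\<beta> / (r * C) + (1 - (lam + \<beta>) / C) = 1 - \<delta>"
          using weights_sum(2) unfolding \<delta>_def by linarith
        finally show ?thesis .
      qed
      also have "\<dots> = (1 - \<delta> ^ Suc j) * M"
        by (simp add: algebra_simps)
      finally show ?case
        by (simp only: i_def)
    qed
    have "f (m, \<sigma>) \<le> (1 - \<delta> ^ nat (int N - m)) * M"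
      using ladder[of "nat (int N - m)"] that(3,4) by simp
    also have "\<dots> \<le> (1 - \<delta> ^ N) * M"
      using \<delta> that by (intro mult_right_mono diff_left_mono power_decreasing) auto
    finally show ?thesis .
  qed
  define q where "q = 1 - \<delta> ^ N"
  have q: "0 \<le> q" "q < 1"
    using \<delta> by (auto simp: q_def power_le_one)
  have "f (m, \<sigma>) \<le> q ^ k * K" if "0 < m" "m \<le> int N" for k m \<sigma>
    using that
  proof (induction k arbitrary: m \<sigma>)
    case (Suc k)
    then show ?case
      using improve[of "q ^ k * K" m \<sigma>] q \<open>0 \<le> K\<close> by (simp add: q_def mult.assoc)
  qed (simp add: bounded)
  moreover have "(\<lambda>k. q ^ k * K) \<longlonglongrightarrow> 0 * K"
    using q by (intro tendsto_mult_right LIMSEQ_power_zero) simp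
  ultimately show ?thesis
    using assms(6,7) by (intro LIMSEQ_le_const[of "\<lambda>k. q ^ k * K"]) auto
qed

text \<open>For the upper bound, the excess \<open>D\<close> is harmonic at positive levels,
  vanishes at \<open>(0, Up)\<close> and is at most \<open>K * \<gamma> powi m\<close>. On the strip
  of height \<open>N\<close> the maximum principle gives \<open>D \<le> K * \<gamma> ^ N\<close>,
  and \<open>N\<close> tends to infinity.\<close>

lemma stay_pos:
  assumes "0 < m"
  shows "stay (m, \<sigma>) = 1 - recip_h (m, \<sigma>)"
proof (rule antisym)
  define D where "D z = killed stay z - (1 - recip_h z)" for z
  \<comment> \<open>\<open>K\<close> dominates both coefficients 1 and \<open>1 / r\<close> of
    \<open>\<gamma> powi m\<close> in \<open>recip_h\<close>.\<close>
  define K where "K = max 1 (1 / r)"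
  have "0 < K"
    by (simp add: K_def)
  have recip_h_le: "recip_h (m, \<sigma>) \<le> K * \<gamma> powi m" for m \<sigma>
    using gamma_pos r_pos mult_right_mono[of 1 K "\<gamma> powi m"] mult_right_mono[of "1 / r" K "\<gamma> powi m"]
    by (cases \<sigma>) (auto simp: K_def)
  have D_le: "D (m, \<sigma>) \<le> K * \<gamma> powi m" if "0 < m" for m \<sigma>
    using recip_h_le[of m \<sigma>] stay_le_one[of "(m, \<sigma>)"] that by (simp add: D_def killed_simps)
  have D_harmonic: "transition (\<lambda>z. D z - c) (m, \<sigma>) = D (m, \<sigma>) - c" if "0 < m" for c m \<sigma>
    unfolding D_def using that
    by (simp only: transition_diff transition_const transition_recip_h stay_first_step[symmetric])
       (simp add: killed_simps)
  have "D (m, \<sigma>) \<le> K * \<gamma> ^ N" if "m \<le> int N" for N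
  proof -
    \<comment> \<open>Subtracting the bound for \<open>D\<close> at level \<open>N\<close> makes the
      top boundary values nonpositive; constants preserve harmonicity.\<close>
    have "D (m, \<sigma>) - K * \<gamma> ^ N \<le> 0"
    proof (rule maximum_principle[where N = N and K = K])
      show "D (int N, \<sigma>) - K * \<gamma> ^ N \<le> 0" for \<sigma>
        using D_le[of "int N" \<sigma>] assms that by simp
      show "D (0, Up) - K * \<gamma> ^ N \<le> 0"
        using gamma_pos \<open>0 < K\<close> by (simp add: D_def killed_simps)
      show "D (m, \<sigma>) - K * \<gamma> ^ N \<le> K" if "0 < m" for m \<sigma>
      proof -
        have "\<gamma> powi m \<le> 1"
          using gamma_pos gamma_less_one that by (simp add: power_int_def power_le_one)
        then have "K * \<gamma> powi m \<le> K"
          using \<open>0 < K\<close> by simp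
        moreover have "0 \<le> K * \<gamma> ^ N"
          using gamma_pos \<open>0 < K\<close> by simp
        ultimately show ?thesis
          using D_le[OF that, of \<sigma>] by linarith
      qed
    qed (use assms that \<open>0 < K\<close> D_harmonic in auto)
    then show ?thesis
      by simp
  qed
  moreover have "(\<lambda>N. K * \<gamma> ^ N) \<longlonglongrightarrow> K * 0"
    using gamma_pos gamma_less_one by (intro tendsto_mult_left LIMSEQ_power_zero) simp
  ultimately have "D (m, \<sigma>) \<le> 0"
    by (intro LIMSEQ_le_const[of "\<lambda>N. K * \<gamma> ^ N"]) (auto intro!: exI[of _ "nat m"])
  with assms show "stay (m, \<sigma>) \<le> 1 - recip_h (m, \<sigma>)"
    by (simp add: D_def killed_simps)
qed (rule stay_ge[OF assms])

text \<open>Only the upward step leads from \<open>(0, Up)\<close> to a positive level, and survival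
  from \<open>(1, Up)\<close> has probability \<open>1 - \<gamma>\<close>.\<close>

lemma stay_0_Up: "stay (0, Up) = lam / (\<gamma> * C) * (1 - \<gamma>)"
  by (subst stay_first_step) (simp add: killed_simps stay_pos)

end

section \<open>The limit of small breakdown rate\<close>

text \<open>At \<open>\<alpha> = 0\<close> the radicand is a perfect square; the hypothesis fixes
  the sign of its root.\<close>

lemma sqrt_s1_tendsto:
  assumes "\<mu> < lam + \<beta>"
  shows "((\<lambda>\<alpha>. sqrt (s1 lam \<mu> \<alpha> \<beta>)) \<longlongrightarrow> lam + \<beta> - \<mu>) (at_right 0)"
proof -
  have "((\<lambda>\<alpha>. sqrt (s1 lam \<mu> \<alpha> \<beta>)) \<longlongrightarrow> sqrt ((\<mu> - lam - \<beta> - 0)\<^sup>2 + 4 * 0 * \<mu>)) (at_right 0)"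
    unfolding s1_def by (intro tendsto_intros)
  moreover have "sqrt ((\<mu> - lam - \<beta> - 0)\<^sup>2 + 4 * 0 * \<mu>) = lam + \<beta> - \<mu>"
    using assms by (simp add: real_sqrt_abs)
  ultimately show ?thesis
    by simp
qed

lemma
  assumes "\<mu> < lam + \<beta>"
  shows s1_sum_tendsto:
      "((\<lambda>\<alpha>. lam + \<beta> + \<mu> + \<alpha> - sqrt (s1 lam \<mu> \<alpha> \<beta>)) \<longlongrightarrow> 2 * \<mu>) (at_right 0)"
    and s1_diff_tendsto:
      "((\<lambda>\<alpha>. lam + \<beta> - \<mu> - \<alpha> + sqrt (s1 lam \<mu> \<alpha> \<beta>)) \<longlongrightarrow> 2 * (lam + \<beta> - \<mu>)) (at_right 0)"
proof -
  have "((\<lambda>\<alpha>. lam + \<beta> + \<mu> + \<alpha> - sqrt (s1 lam \<mu> \<alpha> \<beta>)) \<longlongrightarrow> lam + \<beta> + \<mu> + 0 - (lam + \<beta> - \<mu>)) (at_right 0)"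
    by (intro tendsto_intros sqrt_s1_tendsto assms)
  then show "((\<lambda>\<alpha>. lam + \<beta> + \<mu> + \<alpha> - sqrt (s1 lam \<mu> \<alpha> \<beta>)) \<longlongrightarrow> 2 * \<mu>) (at_right 0)"
    by simp
  have "((\<lambda>\<alpha>. lam + \<beta> - \<mu> - \<alpha> + sqrt (s1 lam \<mu> \<alpha> \<beta>)) \<longlongrightarrow> lam + \<beta> - \<mu> - 0 + (lam + \<beta> - \<mu>)) (at_right 0)"
    by (intro tendsto_intros sqrt_s1_tendsto assms)
  then show "((\<lambda>\<alpha>. lam + \<beta> - \<mu> - \<alpha> + sqrt (s1 lam \<mu> \<alpha> \<beta>)) \<longlongrightarrow> 2 * (lam + \<beta> - \<mu>)) (at_right 0)"
    by (simp add: algebra_simps)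
qed

lemma gamma1_tendsto:
  assumes "0 < \<mu>" and "\<mu> < lam + \<beta>"
  shows "((\<lambda>\<alpha>. gamma1 lam \<mu> \<alpha> \<beta>) \<longlongrightarrow> lam / \<mu>) (at_right 0)"
proof -
  have "((\<lambda>\<alpha>. gamma1 lam \<mu> \<alpha> \<beta>) \<longlongrightarrow> 2 * lam / (2 * \<mu>)) (at_right 0)"
    unfolding gamma1_def using assms by (intro tendsto_intros s1_sum_tendsto) auto
  then show ?thesis
    by simp
qed

lemma G1_tendsto:
  assumes "\<mu> < lam + \<beta>"
  shows "((\<lambda>\<alpha>. G1 lam \<mu> \<alpha> \<beta>) \<longlongrightarrow> lam + \<beta> - \<mu>) (at_right 0)"
proof -
  have "((\<lambda>\<alpha>. G1 lam \<mu> \<alpha> \<beta>) \<longlongrightarrow>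
      2 * (lam + \<beta> - \<mu>) / 2 + 2 * 0 * \<beta> / (2 * (lam + \<beta> - \<mu>))) (at_right 0)"
    unfolding G1_def using assms by (intro tendsto_intros s1_diff_tendsto) auto
  then show ?thesis
    by (simp del: distrib_left_numeral right_diff_distrib_numeral)
qed

lemma d1_tendsto:
  assumes "0 < \<mu>" and "\<mu> < lam + \<beta>"
  shows "((\<lambda>\<alpha>. d1 C lam \<mu> \<alpha> \<beta>) \<longlongrightarrow> (\<mu> - lam) / C) (at_right 0)"
proof -
  have "((\<lambda>\<alpha>. d1 C lam \<mu> \<alpha> \<beta>) \<longlongrightarrow> 1 / C * (2 * \<mu> / 2
      - 1 / (lam + \<beta> - \<mu>) * lam * \<mu> * (2 * (lam + \<beta> - \<mu>) / (2 * \<mu>)))) (at_right 0)"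
    unfolding d1_def using assms
    by (intro tendsto_intros s1_sum_tendsto s1_diff_tendsto G1_tendsto) auto
  also have "1 / C * (2 * \<mu> / 2 - 1 / (lam + \<beta> - \<mu>) * lam * \<mu> * (2 * (lam + \<beta> - \<mu>) / (2 * \<mu>)))
      = (\<mu> - lam) / C"
    using assms by (simp del: distrib_left_numeral right_diff_distrib_numeral)
  finally show ?thesis .
qed

theorem corollary2p2:
  fixes lam \<mu> \<beta> C :: real
    and P :: "real \<Rightarrow> real \<Rightarrow> nat \<times> status \<Rightarrow> (nat \<times> status) pmf"
    and p :: "real \<Rightarrow> (nat \<times> status) pmf"
  assumes "lam > 0" and "\<mu> > 0" and "\<beta> > 0" and "\<mu> < lam + \<beta>"
    and "\<exists>\<alpha>>0. lam < \<beta> / (\<alpha> + \<beta>) * \<mu>"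
    and "eventually (\<lambda>\<alpha>. C \<ge> lam + \<mu> + \<alpha> + \<beta>) (at_right 0)"
    and "\<And>\<alpha>. \<alpha> > 0 \<Longrightarrow> lam < \<beta> / (\<alpha> + \<beta>) * \<mu> \<Longrightarrow> ctmc (rate1 lam \<mu> \<alpha> \<beta>) (P \<alpha>)"
    and "\<And>\<alpha>. \<alpha> > 0 \<Longrightarrow> lam < \<beta> / (\<alpha> + \<beta>) * \<mu> \<Longrightarrow> stationary_distribution (P \<alpha>) (p \<alpha>)"
  shows "\<exists>L :: nat \<Rightarrow> real.
    (\<forall>k. ((\<lambda>\<alpha>. pmf (p \<alpha>) (k, Up)
              / (CU1 C lam \<mu> \<alpha> \<beta> (p \<alpha>) * gamma1 lam \<mu> \<alpha> \<beta> ^ k)) \<longlongrightarrow> L k) (at_right 0)) \<and>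
    L \<longlonglongrightarrow> 1"
proof -
  define \<rho> where "\<rho> = lam / \<mu>"
  have "lam < \<mu>"
  proof -
    obtain \<alpha> where "0 < \<alpha>" "lam < \<beta> / (\<alpha> + \<beta>) * \<mu>"
      using assms(5) by blast
    moreover have "\<beta> / (\<alpha> + \<beta>) * \<mu> \<le> 1 * \<mu>"
      using \<open>0 < \<alpha>\<close> assms by (intro mult_right_mono) auto
    ultimately show ?thesis
      by simp
  qed
  then have \<rho>: "0 < \<rho>" "\<rho> < 1"
    using assms by (simp_all add: \<rho>_def)
  have pos: "eventually (\<lambda>\<alpha>::real. 0 < \<alpha>) (at_right 0)"
    by (rule eventually_at_right_less)
  have up_fraction: "((\<lambda>\<alpha>. \<beta> / (\<alpha> + \<beta>)) \<longlongrightarrow> \<beta> / (0 + \<beta>)) (at_right 0)"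
    using assms by (intro tendsto_intros) auto
  then have "((\<lambda>\<alpha>. \<beta> / (\<alpha> + \<beta>) * \<mu>) \<longlongrightarrow> \<beta> / (0 + \<beta>) * \<mu>) (at_right 0)"
    by (rule tendsto_mult_right)
  then have stable: "eventually (\<lambda>\<alpha>. lam < \<beta> / (\<alpha> + \<beta>) * \<mu>) (at_right 0)"
    using assms \<open>lam < \<mu>\<close> by (intro order_tendstoD(1)) auto
  \<comment> \<open>\<open>C\<close> does not depend on \<open>\<alpha>\<close>, so an eventual
    statement about it holds outright.\<close>
  have "eventually (\<lambda>\<alpha>::real. 0 < C) (at_right 0)"
    using pos assms(6) by eventually_elim (use assms in linarith)
  then have C: "0 < C"
    by simp

  note gamma = gamma1_tendsto[OF assms(2,4), folded \<rho>_def]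
  \<comment> \<open>The limit \<open>\<rho>\<close> of \<open>gamma1\<close> lies strictly between 0
    and 1, so \<open>gamma1\<close> does too for small \<open>\<alpha>\<close>.\<close>
  have ev: "eventually (\<lambda>\<alpha>. twisted_model1 lam \<mu> \<alpha> \<beta> C) (at_right 0)"
  proof -
    have "eventually (\<lambda>\<alpha>. 0 < lam + \<beta> - \<mu> - \<alpha> + sqrt (s1 lam \<mu> \<alpha> \<beta>)) (at_right 0)"
      using assms(4) by (intro order_tendstoD(1)[OF s1_diff_tendsto]) auto
    with pos assms(6) order_tendstoD(1)[OF gamma \<rho>(1)] order_tendstoD(2)[OF gamma \<rho>(2)]
    show ?thesis
      by eventually_elim (use assms in \<open>unfold_locales, auto\<close>)
  qed

  have Up_0: "((\<lambda>\<alpha>. pmf (p \<alpha>) (0, Up)) \<longlongrightarrow> 1 - \<rho>) (at_right 0)"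
  proof -
    have "((\<lambda>\<alpha>. \<beta> / (\<alpha> + \<beta>) - lam / \<mu>) \<longlongrightarrow> \<beta> / (0 + \<beta>) - lam / \<mu>) (at_right 0)"
      by (intro tendsto_intros up_fraction)
    then show ?thesis
    proof (rule Lim_transform_eventually[THEN tendsto_eq_rhs])
      show "eventually (\<lambda>\<alpha>. \<beta> / (\<alpha> + \<beta>) - lam / \<mu> = pmf (p \<alpha>) (0, Up)) (at_right 0)"
        using pos stable by eventually_elim (rule stationary_Up_0[OF assms(1,2) _ assms(3,7,8), symmetric])
    qed (use assms in \<open>simp add: \<rho>_def\<close>)
  qed
  have Down: "((\<lambda>\<alpha>. pmf (p \<alpha>) (x, Down)) \<longlongrightarrow> 0) (at_right 0)" for x
  proof (rule tendsto_sandwich[where f = "\<lambda>_. 0"])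
    have "((\<lambda>\<alpha>. \<alpha> / (\<alpha> + \<beta>)) \<longlongrightarrow> 0 / (0 + \<beta>)) (at_right 0)"
      using assms by (intro tendsto_intros) auto
    then show "((\<lambda>\<alpha>. \<alpha> / (\<alpha> + \<beta>)) \<longlongrightarrow> 0) (at_right 0)"
      by simp
    show "eventually (\<lambda>\<alpha>. pmf (p \<alpha>) (x, Down) \<le> \<alpha> / (\<alpha> + \<beta>)) (at_right 0)"
      using pos stable by eventually_elim (rule stationary_Down_le[OF assms(1,2) _ assms(3,7,8)])
  qed simp_all
  have Up: "((\<lambda>\<alpha>. pmf (p \<alpha>) (k, Up)) \<longlongrightarrow> (1 - \<rho>) * \<rho> ^ k) (at_right 0)" for k
  proof (induction k)
    case 0
    with Up_0 show ?case by simp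
  next
    case (Suc k)
    have "((\<lambda>\<alpha>. lam / \<mu> * (pmf (p \<alpha>) (k, Up) + pmf (p \<alpha>) (k, Down)))
        \<longlongrightarrow> lam / \<mu> * ((1 - \<rho>) * \<rho> ^ k + 0)) (at_right 0)"
      by (intro tendsto_intros Suc Down)
    then show ?case
    proof (rule Lim_transform_eventually[THEN tendsto_eq_rhs])
      show "eventually (\<lambda>\<alpha>. lam / \<mu> * (pmf (p \<alpha>) (k, Up) + pmf (p \<alpha>) (k, Down))
          = pmf (p \<alpha>) (Suc k, Up)) (at_right 0)"
        using pos stable by eventually_elim (rule stationary_Up_Suc[OF assms(1,2) _ assms(3,7,8), symmetric])
    qed (simp add: \<rho>_def)
  qed

  have stay_Up: "((\<lambda>\<alpha>. stay_positive_prob C lam \<mu> \<alpha> \<beta> (0, Up)) \<longlongrightarrow> (\<mu> - lam) / C) (at_right 0)"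
  proof -
    have "((\<lambda>\<alpha>. lam / (gamma1 lam \<mu> \<alpha> \<beta> * C) * (1 - gamma1 lam \<mu> \<alpha> \<beta>))
        \<longlongrightarrow> lam / (\<rho> * C) * (1 - \<rho>)) (at_right 0)"
      using \<rho> C by (intro tendsto_intros gamma) auto
    then show ?thesis
    proof (rule Lim_transform_eventually[THEN tendsto_eq_rhs])
      show "eventually (\<lambda>\<alpha>. lam / (gamma1 lam \<mu> \<alpha> \<beta> * C) * (1 - gamma1 lam \<mu> \<alpha> \<beta>)
          = stay_positive_prob C lam \<mu> \<alpha> \<beta> (0, Up)) (at_right 0)"
        using ev by eventually_elim (rule twisted_model1.stay_0_Up[symmetric])
    qed (use assms C in \<open>simp add: \<rho>_def field_simps\<close>)
  qed
  have h1_Down: "((\<lambda>\<alpha>. h1 lam \<mu> \<alpha> \<beta> (0, Down)) \<longlongrightarrow> 2 * \<beta> / (2 * (lam + \<beta> - \<mu>))) (at_right 0)"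
    unfolding h1.simps minus_zero power_int_0_right mult_1
    using assms by (intro tendsto_intros s1_diff_tendsto) auto
  \<comment> \<open>The stationary mass tends to 0, \<open>h1\<close> has a finite limit, and the
    survival probability lies in [0, 1].\<close>
  have stay_Down: "((\<lambda>\<alpha>. pmf (p \<alpha>) (0, Down) * h1 lam \<mu> \<alpha> \<beta> (0, Down)
      * stay_positive_prob C lam \<mu> \<alpha> \<beta> (0, Down)) \<longlongrightarrow> 0) (at_right 0)"
  proof (rule Lim_null_comparison)
    show "eventually (\<lambda>\<alpha>. norm (pmf (p \<alpha>) (0, Down) * h1 lam \<mu> \<alpha> \<beta> (0, Down)
        * stay_positive_prob C lam \<mu> \<alpha> \<beta> (0, Down))
        \<le> \<bar>pmf (p \<alpha>) (0, Down) * h1 lam \<mu> \<alpha> \<beta> (0, Down)\<bar>) (at_right 0)"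
      using ev
    proof eventually_elim
      case (elim \<alpha>)
      then show ?case
        using twisted_model1.stay_le_one[OF elim] twisted_model1.stay_nonneg[OF elim]
        by (simp only: real_norm_def abs_mult) (intro mult_left_le; simp)
    qed
    show "((\<lambda>\<alpha>. \<bar>pmf (p \<alpha>) (0, Down) * h1 lam \<mu> \<alpha> \<beta> (0, Down)\<bar>) \<longlongrightarrow> 0) (at_right 0)"
      using tendsto_rabs[OF tendsto_mult[OF Down h1_Down]] by simp
  qed
  have "((\<lambda>\<alpha>. pmf (p \<alpha>) (0, Up) * stay_positive_prob C lam \<mu> \<alpha> \<beta> (0, Up)
      + pmf (p \<alpha>) (0, Down) * h1 lam \<mu> \<alpha> \<beta> (0, Down) * stay_positive_prob C lam \<mu> \<alpha> \<beta> (0, Down))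
      \<longlongrightarrow> (1 - \<rho>) * ((\<mu> - lam) / C) + 0) (at_right 0)"
    by (intro tendsto_intros Up_0 stay_Up stay_Down)
  then have eta: "((\<lambda>\<alpha>. eta1 C lam \<mu> \<alpha> \<beta> (p \<alpha>)) \<longlongrightarrow> (1 - \<rho>) * ((\<mu> - lam) / C)) (at_right 0)"
    unfolding eta1_def by simp
  \<comment> \<open>The limit of \<open>d1\<close> is nonzero since \<open>lam < \<mu>\<close>; it
    cancels the factor \<open>(\<mu> - lam) / C\<close> of \<open>eta1\<close>, and the limit of
    \<open>G1\<close> cancels the last factor.\<close>
  have "((\<lambda>\<alpha>. CU1 C lam \<mu> \<alpha> \<beta> (p \<alpha>)) \<longlongrightarrow> (1 - \<rho>) * ((\<mu> - lam) / C) / ((\<mu> - lam) / C)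
      * (1 / (lam + \<beta> - \<mu>)) * (2 * (lam + \<beta> - \<mu>) / 2)) (at_right 0)"
    unfolding CU1_def using assms C \<open>lam < \<mu>\<close>
    by (intro tendsto_intros eta d1_tendsto G1_tendsto s1_diff_tendsto) auto
  then have CU: "((\<lambda>\<alpha>. CU1 C lam \<mu> \<alpha> \<beta> (p \<alpha>)) \<longlongrightarrow> 1 - \<rho>) (at_right 0)"
    using assms C \<open>lam < \<mu>\<close> by (simp del: distrib_left_numeral right_diff_distrib_numeral)
  have "((\<lambda>\<alpha>. pmf (p \<alpha>) (k, Up) / (CU1 C lam \<mu> \<alpha> \<beta> (p \<alpha>) * gamma1 lam \<mu> \<alpha> \<beta> ^ k)) \<longlongrightarrow> 1)
      (at_right 0)" for k
  proof -
    have "((\<lambda>\<alpha>. pmf (p \<alpha>) (k, Up) / (CU1 C lam \<mu> \<alpha> \<beta> (p \<alpha>) * gamma1 lam \<mu> \<alpha> \<beta> ^ k))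
        \<longlongrightarrow> (1 - \<rho>) * \<rho> ^ k / ((1 - \<rho>) * \<rho> ^ k)) (at_right 0)"
      using \<rho> by (intro tendsto_intros Up CU gamma) auto
    with \<rho> show ?thesis
      by simp
  qed
  then show ?thesis
    by (intro exI[of _ "\<lambda>_. 1"]) simp
qed

end
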